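(* Let $\mathbb{K}/\mathbb{F}$ be an extension of finite fields, let $\mathcal{C}$ be an $[N,K]_{\mathbb{F}}$ storage code with generator matrix $\mathbf{G}_{\mathcal{C}}$ in systematic form, let $\mathcal{D}$ be an $[N,T]_{\mathbb{F}}$ MDS code, let $\mathcal{Q}$ be an $\mathbb{F}$-linear query space (an $\mathbb{F}$-subspace of the space of all functions $\mathbb{K}^{M\times 1}\to\mathbb{K}$), and let $\mathsf{Q}$ be a random variable on $\mathcal{Q}^B$, from which the functions $(\phi_1,\ldots,\phi_B)$ are sampled. Put $\mathcal{E}=\mathcal{C}^{\mathcal{Q}}\star\mathcal{D}_{\mathbb{K}}$, let $D_{\mathcal{E}}$ be the minimum distance of $\mathcal{E}$, and let $F=\min\{D_{\mathcal{E}}-1,K\}$. Assume that $F$ divides $KB$. Then the systematic star-product PC scheme built from $\mathcal{C}$, $\mathcal{D}$, $\mathcal{Q}$ (described in the context) is a PC scheme that is $T$-private and has rate $R=F/N$.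
   Context: **Private Computation (PC) model.** Let $\mathbb{K}/\mathbb{F}$ be an extension of finite fields. A data matrix $\mathbf{X}=[\mathbf{x}_1\cdots\mathbf{x}_K]\in\mathbb{K}^{M\times K}$ is encoded with an $[N,K]_{\mathbb{F}}$ linear code $\mathcal{C}$ with generator matrix $\mathbf{G}_{\mathcal{C}}\in\mathbb{F}^{K\times N}$ as $\mathbf{Y}=\mathbf{X}\cdot\mathbf{G}_{\mathcal{C}}=[\mathbf{y}_1\cdots\mathbf{y}_N]\in\mathbb{K}^{M\times N}$; server $n$ stores $\mathbf{y}_n\in\mathbb{K}^{M\times 1}$. Systematic form means the first $K$ columns of $\mathbf{G}_{\mathcal{C}}$ form the identity matrix, so $\mathbf{y}_k=\mathbf{x}_k$ for $k\le K$. Let $\mathcal{F}$ be the set of all functions $\mathbb{K}^{M\times 1}\to\mathbb{K}$. A PC scheme with block length $B$ consists of: a query space $\mathcal{Q}\subseteq\mathcal{F}$ and a random variable $\mathsf{Q}$ on $\mathcal{Q}^B$ (both public) from which functions $\phi_1,\ldots,\phi_B$ are sampled; queries $\rho_1,\ldots,\rho_N\in\mathcal{Q}$, with $\rho_n$ sent to server $n$; responses $\rho_n(\mathbf{y}_n)\in\mathbb{K}$, giving the user the total response vector $\boldsymbol{\rho}(\mathbf{Y})=[\rho_1(\mathbf{y}_1),\ldots,\rho_N(\mathbf{y}_N)]$; and the repetition of the query/response steps a total of $S$ times (with new queries each time) such that all values $\phi_b(\mathbf{x}_k)$, $1\le b\le B$, $1\le k\le K$, can be computed by the user from the $S$ total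 response vectors. **Rate.** The (download) rate is $R=\frac{KB}{NS}$. **Privacy.** A PC scheme protects against a set of servers $\mathcal{T}\subseteq[N]$ if $I(\mathsf{Q};\mathsf{P}_{\mathcal{T}})=0$ (mutual information), where $\mathsf{P}_{\mathcal{T}}$ is the random variable given by all queries sent to all servers in $\mathcal{T}$ over all $S$ iterations. It is $T$-private if it protects against every $\mathcal{T}\subseteq[N]$ with $|\mathcal{T}|=T$. **Codes.** An $[N,T]_{\mathbb{F}}$ code is MDS if its minimum distance is $N-T+1$. For linear codes of length $N$ over the same field, the star product $\mathcal{A}\star\mathcal{B}$ is the span of all coordinatewise products $\mathbf{a}\star\mathbf{b}=[\mathbf{a}(1)\mathbf{b}(1),\ldots,\mathbf{a}(N)\mathbf{b}(N)]$, $\mathbf{a}\in\mathcal{A}$, $\mathbf{b}\in\mathcal{B}$. For a code $\mathcal{A}\subseteq\mathbb{F}^{1\times N}$, $\mathcal{A}_{\mathbb{K}}\subseteq\mathbb{K}^{1\times N}$ is its $\mathbb{K}$-span. Define $$\mathcal{C}^{\mathcal{Q}}=\mathrm{span}_{\mathbb{K}}\{[\psi(\mathbf{y}_1),\ldots,\psi(\mathbf{y}_N)]\ :\ \psi\in\mathcal{Q},\ [\mathbf{y}_1,\ldots,\mathbf{y}_N]=\mathbf{X}\cdot\mathbf{G}_{\mathcal{C}},\ \mathbf{X}\in\mathbb{K}^{M\times K}\}\subseteq\mathbb{K}^{1\times N}.$$ **The scheme.** Fix an $\mathbb{F}$-basis $\{\psi^1,\ldots,\psi^Q\}$ of $\mathcal{Q}$.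 There are $S=KB/F$ iterations. List the pairs $(b,k)$, $1\le b\le B$, $1\le k\le K$, in lexicographic order $(1,1),\ldots,(1,K),(2,1),\ldots,(B,K)$ and cut this list into $S$ consecutive blocks of $F$ pairs; since $F\le K$, the pairs in one block have distinct second entries. In iteration $s$, sample $\mathbf{d}^1,\ldots,\mathbf{d}^Q\in\mathcal{D}$ independently and uniformly (independently of $(\phi_1,\ldots,\phi_B)$ and of the other iterations), and put $\psi_n=\mathbf{d}^1(n)\psi^1+\cdots+\mathbf{d}^Q(n)\psi^Q\in\mathcal{Q}$ for $n=1,\ldots,N$. The queries are $\rho_k=\psi_k+\phi_b$ for each pair $(b,k)$ in the $s$-th block, and $\rho_n=\psi_n$ for all other servers $n$. From the total response vector the user recovers the $F$ values $\phi_b(\mathbf{x}_k)$, $(b,k)$ in the $s$-th block, by right-multiplying by a parity-check matrix $\mathbf{H}_{\mathcal{E}}$ of $\mathcal{E}$ and solving for the "errors" $\phi_b(\mathbf{x}_k)$ in the known positions $k$. *)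

theory Defs
  imports
    "HOL-Analysis.Analysis"
    "HOL-Probability.Probability"
    "HOL-Library.Function_Algebras"
begin

section \<open>Field extensions and linear codes\<close>

text \<open>An extension of fields is given by an embedding of the small field into the large one.\<close>

definition field_embedding :: "('f::field \<Rightarrow> 'k::field) \<Rightarrow> bool" where
  "field_embedding emb \<longleftrightarrow>
     emb 1 = 1 \<and> (\<forall>x y. emb (x + y) = emb x + emb y) \<and> (\<forall>x y. emb (x * y) = emb x * emb y)"

text \<open>
  A row vector of length \<open>N\<close> is a function on the coordinates \<open>{1..N}\<close>, extended by 0 to all of
  \<open>nat\<close>. Addition of such functions is the pointwise one of \<^theory>\<open>HOL-Library.Function_Algebras\<close>.
\<close>

definition row_vectors :: "nat \<Rightarrow> (nat \<Rightarrow> 'a::zero) set" where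
  "row_vectors N = {v. \<forall>n. n \<notin> {1..N} \<longrightarrow> v n = 0}"

definition row_scale :: "'a::field \<Rightarrow> (nat \<Rightarrow> 'a) \<Rightarrow> nat \<Rightarrow> 'a" where
  "row_scale c v = (\<lambda>n. c * v n)"

interpretation row: vector_space "row_scale :: 'a::field \<Rightarrow> _"
  by unfold_locales (auto simp: row_scale_def fun_eq_iff algebra_simps)

definition linear_code :: "nat \<Rightarrow> nat \<Rightarrow> (nat \<Rightarrow> 'a::field) set \<Rightarrow> bool" where
  "linear_code N K C \<longleftrightarrow> C \<subseteq> row_vectors N \<and> row.subspace C \<and> row.dim C = K"

text \<open>A matrix with entries \<open>G k n\<close> has the rows \<open>G k\<close>.\<close>

definition generator_matrix ::
    "nat \<Rightarrow> nat \<Rightarrow> (nat \<Rightarrow> nat \<Rightarrow> 'a::field) \<Rightarrow> (nat \<Rightarrow> 'a) set \<Rightarrow> bool" where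
  "generator_matrix N K G C \<longleftrightarrow> (\<forall>k\<in>{1..K}. G k \<in> row_vectors N) \<and> C = row.span (G ` {1..K})"

definition systematic :: "nat \<Rightarrow> (nat \<Rightarrow> nat \<Rightarrow> 'a::field) \<Rightarrow> bool" where
  "systematic K G \<longleftrightarrow> (\<forall>k\<in>{1..K}. \<forall>n\<in>{1..K}. G k n = (if n = k then 1 else 0))"

definition hamming_dist :: "nat \<Rightarrow> (nat \<Rightarrow> 'a) \<Rightarrow> (nat \<Rightarrow> 'a) \<Rightarrow> nat" where
  "hamming_dist N u v = card {n \<in> {1..N}. u n \<noteq> v n}"

text \<open>
  A code with a single codeword has no pair of distinct codewords. It gets minimum distance
  \<open>N + 1\<close>, so that the zero code of dimension 0 attains the Singleton bound \<open>N - 0 + 1\<close>.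
\<close>

definition min_dist :: "nat \<Rightarrow> (nat \<Rightarrow> 'a) set \<Rightarrow> nat" where
  "min_dist N C =
     (if \<exists>u\<in>C. \<exists>v\<in>C. u \<noteq> v
      then Inf {hamming_dist N u v | u v. u \<in> C \<and> v \<in> C \<and> u \<noteq> v}
      else N + 1)"

definition MDS_code :: "nat \<Rightarrow> nat \<Rightarrow> (nat \<Rightarrow> 'a::field) set \<Rightarrow> bool" where
  "MDS_code N T C \<longleftrightarrow> linear_code N T C \<and> min_dist N C = N - T + 1"

definition star_product ::
    "(nat \<Rightarrow> 'a::field) set \<Rightarrow> (nat \<Rightarrow> 'a) set \<Rightarrow> (nat \<Rightarrow> 'a) set" where
  "star_product A B = row.span {(\<lambda>n. a n * b n) | a b. a \<in> A \<and> b \<in> B}"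

definition extend_scalars ::
    "('f::field \<Rightarrow> 'k::field) \<Rightarrow> (nat \<Rightarrow> 'f) set \<Rightarrow> (nat \<Rightarrow> 'k) set" where
  "extend_scalars emb A = row.span ((\<lambda>a n. emb (a n)) ` A)"

text \<open>
  The product of the row vector \<open>v\<close> of length \<open>N\<close> with the \<open>j\<close>-th column of a matrix with \<open>N\<close> rows.
\<close>

definition times_column :: "nat \<Rightarrow> (nat \<Rightarrow> 'a::field) \<Rightarrow> (nat \<Rightarrow> nat \<Rightarrow> 'a) \<Rightarrow> nat \<Rightarrow> 'a" where
  "times_column N v H j = (\<Sum>n\<in>{1..N}. v n * H n j)"

text \<open>
  Parity-check matrices are multiplied from the right, so they have \<open>N\<close> rows and
  \<open>N - dim C\<close> columns.
\<close>

definition parity_check_matrix ::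
    "nat \<Rightarrow> (nat \<Rightarrow> 'a::field) set \<Rightarrow> (nat \<Rightarrow> nat \<Rightarrow> 'a) \<Rightarrow> bool" where
  "parity_check_matrix N C H \<longleftrightarrow>
     C = {v \<in> row_vectors N. \<forall>j\<in>{1..N - row.dim C}. times_column N v H j = 0}"

lemma parity_check_matrix_exists:
  fixes C :: "(nat \<Rightarrow> 'a::field) set"
  assumes "row.subspace C" and sub: "C \<subseteq> row_vectors N"
  shows "\<exists>H. parity_check_matrix N C H"
proof -
  let ?V = "row_vectors N :: (nat \<Rightarrow> 'a) set"
  define u :: "nat \<Rightarrow> nat \<Rightarrow> 'a" where "u = (\<lambda>n i. if i = n then 1 else 0)"
  have expand: "v = (\<Sum>n\<in>{1..N}. row_scale (v n) (u n))" if "v \<in> ?V" for v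
  proof
    fix i
    have "(\<Sum>n\<in>{1..N}. row_scale (v n) (u n)) i = (\<Sum>n\<in>{1..N}. if i = n then v n else 0)"
      by (induction N) (auto simp: row_scale_def u_def intro!: sum.cong)
    then show "v i = (\<Sum>n\<in>{1..N}. row_scale (v n) (u n)) i"
      using that by (auto simp: row_vectors_def)
  qed
  have subV: "row.subspace ?V"
    by (auto simp: row.subspace_def row_vectors_def row_scale_def)
  have uV: "u ` {1..N} \<subseteq> ?V" by (auto simp: u_def row_vectors_def)
  have spanu: "?V \<subseteq> row.span (u ` {1..N})"
    by (subst subset_iff, intro allI impI, subst expand, assumption)
      (intro row.span_sum row.span_scale row.span_base, auto)
  have inj: "inj_on u {1..N}"
    by (auto simp: inj_on_def u_def fun_eq_iff split: if_splits)
  have indep: "row.independent (u ` {1..N})"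
  proof (rule row.independent_if_scalars_zero)
    fix f x assume s: "(\<Sum>x\<in>u ` {1..N}. row_scale (f x) x) = 0" and x: "x \<in> u ` {1..N}"
    define v where "v = (\<lambda>n. if n \<in> {1..N} then f (u n) else 0)"
    have "v = (\<Sum>n\<in>{1..N}. row_scale (v n) (u n))"
      by (rule expand) (auto simp: v_def row_vectors_def)
    also have "\<dots> = 0"
      using s unfolding sum.reindex[OF inj] by (simp add: v_def)
    finally show "f x = 0" using x by (auto simp: v_def fun_eq_iff split: if_splits)
  qed simp
  obtain A where A: "A \<subseteq> C" "row.independent A" "C \<subseteq> row.span A" "card A = row.dim C"
    using row.basis_exists by blast
  have spanA: "row.span A = C"
    using A assms(1) by (metis row.span_minimal subset_antisym)
  obtain A' where A': "A \<subseteq> A'" "A' \<subseteq> ?V" "row.independent A'" "?V \<subseteq> row.span A'"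
    using row.maximal_independent_subset_extend[of A ?V] A sub by blast
  have spanA': "row.span A' = ?V"
    using A' subV by (metis row.span_minimal subset_antisym)
  have "row.dim ?V = N"
    using row.dim_unique[OF uV spanu indep] inj by (simp add: card_image)
  then have cardA': "card A' = N"
    using row.dim_unique[OF A'(2,4,3)] by auto
  have finA': "finite A'"
    using row.independent_span_bound[OF _ A'(3), of "u ` {1..N}"] A'(2) spanu by blast
  then have "card (A' - A) = N - row.dim C"
    using A' A cardA' by (simp add: card_Diff_subset finite_subset)
  then obtain h where h: "bij_betw h {1..N - row.dim C} (A' - A)"
    using finA' by (metis finite_Diff ex_bij_betw_nat_finite_1)
  define H where "H = (\<lambda>n j. row.representation A' (u n) (h j))"
  have rep: "times_column N v H j = row.representation A' v (h j)" if "v \<in> ?V" for v j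
  proof -
    have inspan: "u n \<in> row.span A'" if "n \<in> {1..N}" for n
      using uV that spanA' by auto
    have "row.representation A' v
        = row.representation A' (\<Sum>n\<in>{1..N}. row_scale (v n) (u n))"
      using expand[OF that] by simp
    also have "\<dots> = (\<lambda>b. \<Sum>n\<in>{1..N}. row.representation A' (row_scale (v n) (u n)) b)"
      by (rule row.representation_sum) (use A' inspan in \<open>auto intro: row.span_scale\<close>)
    also have "\<dots> = (\<lambda>b. \<Sum>n\<in>{1..N}. v n * row.representation A' (u n) b)"
      using A' inspan by (intro ext sum.cong) (auto simp: row.representation_scale)
    finally show ?thesis by (simp add: times_column_def H_def)
  qed
  have mem: "v \<in> C \<longleftrightarrow> (\<forall>b\<in>A' - A. row.representation A' v b = 0)" if v: "v \<in> ?V" for v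
  proof
    assume "v \<in> C"
    then have "row.representation A' v = row.representation A v"
      using A' spanA by (intro row.representation_extend) auto
    then show "\<forall>b\<in>A' - A. row.representation A' v b = 0"
      using row.representation_ne_zero by fastforce
  next
    assume z: "\<forall>b\<in>A' - A. row.representation A' v b = 0"
    have "v = (\<Sum>b\<in>A'. row_scale (row.representation A' v b) b)"
      using row.sum_representation_eq[OF A'(3), of v A'] v spanA' finA' by simp
    also have "\<dots> \<in> row.span A"
      by (intro row.span_sum) (use z in \<open>metis DiffI row.span_base row.span_scale row.span_zero row.scale_zero_left\<close>)
    finally show "v \<in> C" using spanA by simp
  qed
  have "(\<forall>j\<in>{1..N - row.dim C}. times_column N v H j = 0) \<longleftrightarrow> v \<in> C" if "v \<in> ?V" for v
    unfolding mem[OF that] rep[OF that] bij_betw_imp_surj_on[OF h, symmetric] by simp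
  then have "parity_check_matrix N C H"
    using sub by (auto simp: parity_check_matrix_def)
  then show ?thesis by blast
qed

section \<open>Query spaces\<close>

text \<open>
  Columns of length \<open>M\<close> over the large field are elements of \<open>'k^'m\<close> with \<open>M = CARD('m)\<close>, and
  all functions from these to \<open>'k\<close> are queries.
\<close>

type_synonym ('k, 'm) query = "('k, 'm) vec \<Rightarrow> 'k"

definition query_scale ::
    "('f::field \<Rightarrow> 'k::field) \<Rightarrow> 'f \<Rightarrow> ('k, 'm::finite) query \<Rightarrow> ('k, 'm) query" where
  "query_scale emb c \<psi> = (\<lambda>y. emb c * \<psi> y)"

lemma vector_space_query_scale:
  assumes "field_embedding emb"
  shows "vector_space (query_scale emb)"
  using assms by unfold_locales
    (auto simp: field_embedding_def query_scale_def fun_eq_iff algebra_simps)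

text \<open>\<open>bas ! 0, bas ! 1, \<dots>\<close> is a basis over the small field.\<close>

definition query_basis ::
    "('f::field \<Rightarrow> 'k::field) \<Rightarrow> ('k, 'm::finite) query set \<Rightarrow> ('k, 'm) query list \<Rightarrow> bool" where
  "query_basis emb \<Q> bas \<longleftrightarrow>
     distinct bas \<and> \<not> module.dependent (query_scale emb) (set bas) \<and>
     module.span (query_scale emb) (set bas) = \<Q>"

text \<open>
  \<open>X k\<close> is the \<open>k\<close>-th column of the data matrix, and the result is the \<open>n\<close>-th column of the
  product of the data matrix with \<open>G\<close>.
\<close>

definition stored_column ::
    "('f::field \<Rightarrow> 'k::field) \<Rightarrow> nat \<Rightarrow> (nat \<Rightarrow> nat \<Rightarrow> 'f) \<Rightarrow> (nat \<Rightarrow> ('k, 'm::finite) vec)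
       \<Rightarrow> nat \<Rightarrow> ('k, 'm) vec" where
  "stored_column emb K G X n = (\<Sum>k\<in>{1..K}. emb (G k n) *s X k)"

definition query_code ::
    "('f::field \<Rightarrow> 'k::field) \<Rightarrow> nat \<Rightarrow> nat \<Rightarrow> (nat \<Rightarrow> nat \<Rightarrow> 'f) \<Rightarrow> ('k, 'm::finite) query set
       \<Rightarrow> (nat \<Rightarrow> 'k) set" where
  "query_code emb N K G \<Q> =
     row.span {(\<lambda>n. if n \<in> {1..N} then \<psi> (stored_column emb K G X n) else 0) | \<psi> X. \<psi> \<in> \<Q>}"

section \<open>Private computation schemes\<close>

text \<open>
  All the randomness used by the user is an outcome \<open>\<omega> :: 'w\<close> sampled from \<open>sample\<close>. The tuple
  of functions \<open>\<phi>\<^sub>1, \<dots>, \<phi>\<^sub>B\<close> is the list \<open>funs \<omega>\<close>, so that \<open>\<phi>\<^sub>b = funs \<omega> ! (b - 1)\<close>. The query sent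
  to server \<open>n\<close> in iteration \<open>s\<close> is \<open>query \<omega> s n\<close>. The user, who knows \<open>\<omega>\<close> and the total
  response vectors \<open>r s\<close> of all iterations \<open>s\<close>, computes \<open>decode \<omega> r b k\<close> as the value of
  \<open>\<phi>\<^sub>b\<close> at the \<open>k\<close>-th data column.
\<close>

record ('k, 'm, 'w) pc_scheme =
  num_servers :: nat
  num_files :: nat
  block_length :: nat
  num_iterations :: nat
  query_space :: "('k, 'm::finite) query set"
  fun_law :: "('k, 'm) query list pmf"
  sample :: "'w pmf"
  funs :: "'w \<Rightarrow> ('k, 'm) query list"
  query :: "'w \<Rightarrow> nat \<Rightarrow> nat \<Rightarrow> ('k, 'm) query"
  decode :: "'w \<Rightarrow> (nat \<Rightarrow> nat \<Rightarrow> 'k) \<Rightarrow> nat \<Rightarrow> nat \<Rightarrow> 'k"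

text \<open>The argument \<open>Y\<close> assigns to each server its stored column.\<close>

definition responses ::
    "('k::field, 'm::finite, 'w) pc_scheme \<Rightarrow> (nat \<Rightarrow> ('k, 'm) vec) \<Rightarrow> 'w \<Rightarrow> nat \<Rightarrow> nat \<Rightarrow> 'k" where
  "responses P Y \<omega> s n =
     (if s \<in> {1..num_iterations P} \<and> n \<in> {1..num_servers P} then query P \<omega> s n (Y n) else 0)"

definition is_pc_scheme ::
    "('f::field \<Rightarrow> 'k::field) \<Rightarrow> (nat \<Rightarrow> nat \<Rightarrow> 'f) \<Rightarrow> ('k, 'm::finite, 'w) pc_scheme \<Rightarrow> bool" where
  "is_pc_scheme emb G P \<longleftrightarrow>
     (\<forall>\<phi>\<in>set_pmf (fun_law P). length \<phi> = block_length P \<and> set \<phi> \<subseteq> query_space P) \<and>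
     map_pmf (funs P) (sample P) = fun_law P \<and>
     (\<forall>\<omega>\<in>set_pmf (sample P). \<forall>s\<in>{1..num_iterations P}. \<forall>n\<in>{1..num_servers P}.
        query P \<omega> s n \<in> query_space P) \<and>
     (\<forall>\<omega>\<in>set_pmf (sample P). \<forall>X. \<forall>b\<in>{1..block_length P}. \<forall>k\<in>{1..num_files P}.
        decode P \<omega> (responses P (stored_column emb (num_files P) G X) \<omega>) b k
          = (funs P \<omega> ! (b - 1)) (X k))"

definition rate :: "('k::field, 'm::finite, 'w) pc_scheme \<Rightarrow> real" where
  "rate P = real (num_files P * block_length P) / real (num_servers P * num_iterations P)"

text \<open>All queries sent to the servers in \<open>\<T>\<close>, iteration by iteration.\<close>

definition queries_to ::
    "('k::field, 'm::finite, 'w) pc_scheme \<Rightarrow> nat set \<Rightarrow> 'w \<Rightarrow> ('k, 'm) query list list" where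
  "queries_to P \<T> \<omega> =
     map (\<lambda>s. map (query P \<omega> s) (sorted_list_of_set \<T>)) [1..<Suc (num_iterations P)]"

text \<open>
  Over a finite field \<open>'k\<close> there are only countably many lists of queries, so that on both
  sides every set is measurable, also in the product.
\<close>

definition protects_against ::
    "('k::{field,finite}, 'm::finite, 'w) pc_scheme \<Rightarrow> nat set \<Rightarrow> bool" where
  "protects_against P \<T> \<longleftrightarrow>
     prob_space.mutual_information (measure_pmf (sample P)) 2 (count_space UNIV) (count_space UNIV)
       (funs P) (queries_to P \<T>) = 0"

definition T_private ::
    "nat \<Rightarrow> ('k::{field,finite}, 'm::finite, 'w) pc_scheme \<Rightarrow> bool" where
  "T_private T P \<longleftrightarrow> (\<forall>\<T>. \<T> \<subseteq> {1..num_servers P} \<and> card \<T> = T \<longrightarrow> protects_against P \<T>)"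

section \<open>The systematic star-product scheme\<close>

text \<open>\<open>List.product\<close> enumerates the pairs in lexicographic order.\<close>

definition pair_block :: "nat \<Rightarrow> nat \<Rightarrow> nat \<Rightarrow> nat \<Rightarrow> (nat \<times> nat) set" where
  "pair_block B K F s =
     set (take F (drop ((s - 1) * F) (List.product [1..<Suc B] [1..<Suc K])))"

text \<open>\<open>d j\<close> is the codeword that belongs to the basis element \<open>bas ! (j - 1)\<close>.\<close>

definition mask_query ::
    "('f::field \<Rightarrow> 'k::field) \<Rightarrow> ('k, 'm::finite) query list \<Rightarrow> (nat \<Rightarrow> nat \<Rightarrow> 'f) \<Rightarrow> nat
       \<Rightarrow> ('k, 'm) query" where
  "mask_query emb bas d n = (\<Sum>j\<in>{1..length bas}. query_scale emb (d j n) (bas ! (j - 1)))"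

text \<open>The defining description of the \<open>b\<close> used below is unique, since \<open>F \<le> K\<close>.\<close>

definition star_query ::
    "('f::field \<Rightarrow> 'k::field) \<Rightarrow> nat \<Rightarrow> nat \<Rightarrow> nat \<Rightarrow> ('k, 'm::finite) query list
       \<Rightarrow> ('k, 'm) query list \<Rightarrow> (nat \<Rightarrow> nat \<Rightarrow> nat \<Rightarrow> 'f) \<Rightarrow> nat \<Rightarrow> nat \<Rightarrow> ('k, 'm) query" where
  "star_query emb K B F bas \<phi> d s n =
     (if \<exists>b. (b, n) \<in> pair_block B K F s
      then mask_query emb bas (d s) n + \<phi> ! ((THE b. (b, n) \<in> pair_block B K F s) - 1)
      else mask_query emb bas (d s) n)"

text \<open>
  The user solves the linear system \<open>e H = r H\<close> for the error vector \<open>e\<close> with the known support.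
\<close>

definition solve_errors ::
    "nat \<Rightarrow> (nat \<Rightarrow> 'k::field) set \<Rightarrow> (nat \<Rightarrow> nat \<Rightarrow> 'k) \<Rightarrow> nat set \<Rightarrow> (nat \<Rightarrow> 'k) \<Rightarrow> nat \<Rightarrow> 'k" where
  "solve_errors N E H J r =
     (THE e. (\<forall>n. n \<notin> J \<longrightarrow> e n = 0) \<and>
             (\<forall>j\<in>{1..N - row.dim E}. times_column N e H j = times_column N r H j))"

definition star_decode ::
    "nat \<Rightarrow> nat \<Rightarrow> nat \<Rightarrow> nat \<Rightarrow> nat \<Rightarrow> (nat \<Rightarrow> 'k::field) set \<Rightarrow> (nat \<Rightarrow> nat \<Rightarrow> 'k)
       \<Rightarrow> (nat \<Rightarrow> nat \<Rightarrow> 'k) \<Rightarrow> nat \<Rightarrow> nat \<Rightarrow> 'k" where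
  "star_decode N K B S F E H r b k =
     (let s = (THE s. s \<in> {1..S} \<and> (b, k) \<in> pair_block B K F s)
      in solve_errors N E H (snd ` pair_block B K F s) (r s) k)"

text \<open>
  \<open>d s j\<close> is the codeword sampled in iteration \<open>s\<close> for the \<open>j\<close>-th basis element;
  \<^const>\<open>Pi_pmf\<close> is the distribution of an independent family.
\<close>

definition star_sample ::
    "nat \<Rightarrow> nat \<Rightarrow> (nat \<Rightarrow> 'f::field) set \<Rightarrow> ('k, 'm::finite) query list pmf
       \<Rightarrow> (('k, 'm) query list \<times> (nat \<Rightarrow> nat \<Rightarrow> nat \<Rightarrow> 'f)) pmf" where
  "star_sample S q D law =
     pair_pmf law (Pi_pmf {1..S} 0 (\<lambda>_. Pi_pmf {1..q} 0 (\<lambda>_. pmf_of_set D)))"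

definition star_product_scheme ::
    "('f::field \<Rightarrow> 'k::field) \<Rightarrow> nat \<Rightarrow> nat \<Rightarrow> nat \<Rightarrow> nat \<Rightarrow> (nat \<Rightarrow> 'f) set \<Rightarrow> ('k, 'm::finite) query set
       \<Rightarrow> ('k, 'm) query list \<Rightarrow> ('k, 'm) query list pmf \<Rightarrow> (nat \<Rightarrow> 'k) set \<Rightarrow> (nat \<Rightarrow> nat \<Rightarrow> 'k)
       \<Rightarrow> ('k, 'm, ('k, 'm) query list \<times> (nat \<Rightarrow> nat \<Rightarrow> nat \<Rightarrow> 'f)) pc_scheme" where
  "star_product_scheme emb N K B F D \<Q> bas law E H =
     (let S = K * B div F in
      \<lparr>num_servers = N, num_files = K, block_length = B, num_iterations = S,
       query_space = \<Q>, fun_law = law,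
       sample = star_sample S (length bas) D law,
       funs = fst,
       query = (\<lambda>(\<phi>, d). star_query emb K B F bas \<phi> d),
       decode = (\<lambda>_. star_decode N K B S F E H)\<rparr>)"

end

theory Submission
  imports Defs
begin

section \<open>Independence and mutual information of discrete variables\<close>

text \<open>Mutual information is the KL divergence between the joint law and the product of the
  marginals. A factorised joint pmf makes both measures equal, and the divergence of a measure from
  itself is 0. Privacy thus reduces to an identity between pmfs.\<close>

lemma mutual_information_eq_0_pmf:
  fixes X :: "'w \<Rightarrow> 'a" and Y :: "'w \<Rightarrow> 'b"
  assumes "map_pmf (\<lambda>\<omega>. (X \<omega>, Y \<omega>)) p = pair_pmf \<mu> \<nu>"
  shows "prob_space.mutual_information (measure_pmf p) c (count_space UNIV) (count_space UNIV) X Y = 0"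
proof -
  let ?S = "count_space UNIV :: 'a measure" and ?T = "count_space UNIV :: 'b measure"
  have "map_pmf X p = \<mu>" "map_pmf Y p = \<nu>"
    using arg_cong[OF assms, of "map_pmf fst"] arg_cong[OF assms, of "map_pmf snd"]
    by (simp_all add: pmf.map_comp o_def map_fst_pair_pmf map_snd_pair_pmf)
  then have marginals: "distr (measure_pmf p) ?S X = \<mu>" "distr (measure_pmf p) ?T Y = \<nu>"
    by (auto simp flip: map_pmf_rep_eq)
  \<comment> \<open>For arbitrary types the product sigma-algebra may be coarser than the discrete
    one on pairs, so the two measures are compared on rectangles.\<close>
  have "measure_pmf \<mu> \<Otimes>\<^sub>M measure_pmf \<nu> = distr (measure_pmf p) (?S \<Otimes>\<^sub>M ?T) (\<lambda>\<omega>. (X \<omega>, Y \<omega>))"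
  proof (rule pair_measure_eqI)
    fix A B
    have [measurable]: "A \<in> sets ?S" "B \<in> sets ?T" by simp_all
    have "emeasure (measure_pmf \<mu>) A * emeasure (measure_pmf \<nu>) B
        = (\<integral>\<^sup>+a. \<integral>\<^sup>+b. indicator (A \<times> B) (a, b) \<partial>\<nu> \<partial>\<mu>)"
      by (simp add: indicator_times nn_integral_cmult nn_integral_multc)
    also have "\<dots> = emeasure (map_pmf (\<lambda>\<omega>. (X \<omega>, Y \<omega>)) p) (A \<times> B)"
      unfolding assms by (subst nn_integral_pair_pmf'[symmetric]) simp
    also have "\<dots> = emeasure (distr (measure_pmf p) (?S \<Otimes>\<^sub>M ?T) (\<lambda>\<omega>. (X \<omega>, Y \<omega>))) (A \<times> B)"
      by (subst emeasure_distr) (auto simp: space_pair_measure)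
    finally show "emeasure (measure_pmf \<mu>) A * emeasure (measure_pmf \<nu>) B
      = emeasure (distr (measure_pmf p) (?S \<Otimes>\<^sub>M ?T) (\<lambda>\<omega>. (X \<omega>, Y \<omega>))) (A \<times> B)" .
  next
    show "sets (measure_pmf \<mu> \<Otimes>\<^sub>M measure_pmf \<nu>)
        = sets (distr (measure_pmf p) (?S \<Otimes>\<^sub>M ?T) (\<lambda>\<omega>. (X \<omega>, Y \<omega>)))"
      unfolding sets_distr by (rule sets_pair_measure_cong) simp_all
  qed (auto intro: measure_pmf.sigma_finite_measure_axioms)
  moreover have "prob_space (measure_pmf \<mu> \<Otimes>\<^sub>M measure_pmf \<nu>)"
    by (intro prob_space_pair measure_pmf.prob_space_axioms)
  then have "sigma_finite_measure (measure_pmf \<mu> \<Otimes>\<^sub>M measure_pmf \<nu>)"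
    by (simp add: prob_space_imp_sigma_finite)
  ultimately show ?thesis
    unfolding prob_space.mutual_information_def[OF measure_pmf.prob_space_axioms] marginals
    by (metis sigma_finite_measure.KL_same_eq_0)
qed

section \<open>Minimum distance, interpolation and error recovery\<close>

text \<open>The distance from \<open>v\<close> to the zero word is one of the values in the infimum.
  Applied in contrapositive form: a codeword supported on fewer than \<open>min_dist N C\<close>
  positions vanishes.\<close>

lemma min_dist_le_card_support:
  assumes "0 \<in> C" "v \<in> C" "v \<noteq> 0" "{n \<in> {1..N}. v n \<noteq> 0} \<subseteq> J" "finite J"
  shows "min_dist N C \<le> card J"
proof -
  have "min_dist N C \<le> hamming_dist N v 0"
    using assms unfolding min_dist_def by (auto intro!: cInf_lower)
  also have "\<dots> \<le> card J"
    using assms by (simp add: hamming_dist_def card_mono)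
  finally show ?thesis .
qed

lemma finite_row_vectors: "finite (row_vectors N :: (nat \<Rightarrow> 'a::{zero,finite}) set)"
  using finite_set_of_finite_funs[of "{1..N}" "UNIV :: 'a set" 0] by (simp add: row_vectors_def)

text \<open>Two codewords that agree on \<open>I\<close> are too close to differ, so counting makes restriction
  to \<open>I\<close> a bijection from the code onto all of \<open>I \<rightarrow>\<close> field.\<close>

lemma MDS_code_interpolation:
  fixes D :: "(nat \<Rightarrow> 'a::{field,finite}) set"
  assumes mds: "MDS_code N T D" and I: "I \<subseteq> {1..N}" "card I = T"
  obtains d where "d \<in> D" "\<And>n. n \<in> I \<Longrightarrow> d n = a n"
proof -
  have DN: "D \<subseteq> row_vectors N" and D: "row.subspace D" and dim: "row.dim D = T"
    and dist: "min_dist N D = N - T + 1"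
    using mds by (auto simp: MDS_code_def linear_code_def)
  obtain A where A: "A \<subseteq> D" "row.independent A" "card A = T"
    using row.basis_exists[of D] dim by metis
  have finA: "finite A" using A DN finite_row_vectors finite_subset by metis
  have finI: "finite I" using I finite_subset by blast
  \<comment> \<open>\<open>g\<close> parametrises codewords by coefficient functions on a basis.
    There are as many coefficient functions on \<open>A\<close> as value assignments on
    \<open>I\<close>, because \<open>card A = T = card I\<close>.\<close>
  define g where "g f = (\<Sum>v\<in>A. row_scale (f v) v)" for f
  have gD: "g f \<in> D" for f
    unfolding g_def using A D by (intro row.subspace_sum row.subspace_scale) auto
  have "inj_on (\<lambda>f. restrict (g f) I) (A \<rightarrow>\<^sub>E UNIV)"
  proof (rule inj_onI)
    fix f f' assume ff: "f \<in> A \<rightarrow>\<^sub>E UNIV" "f' \<in> A \<rightarrow>\<^sub>E UNIV" and eq: "restrict (g f) I = restrict (g f') I"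
    define v where "v = g f - g f'"
    have vD: "v \<in> D" unfolding v_def using D gD by (intro row.subspace_diff)
    have "{n \<in> {1..N}. v n \<noteq> 0} \<subseteq> {1..N} - I"
      using eq by (auto simp: v_def restrict_def fun_eq_iff) metis
    moreover have "card ({1..N} - I) = N - T" using I finI by (simp add: card_Diff_subset)
    ultimately have "v = 0"
      using min_dist_le_card_support[of D v N "{1..N} - I"] vD D dist
      by (auto simp: row.subspace_0)
    then have "(\<Sum>x\<in>A. row_scale (f x - f' x) x) = 0"
      by (simp add: v_def g_def row.scale_left_diff_distrib sum_subtractf)
    then have "f x = f' x" if "x \<in> A" for x
      using row.independentD[OF A(2) finA subset_refl _ that, of "\<lambda>x. f x - f' x"] by simp
    then show "f = f'" using ff by (auto intro: PiE_ext)
  qed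
  then have "card ((\<lambda>f. restrict (g f) I) ` (A \<rightarrow>\<^sub>E UNIV)) = card (I \<rightarrow>\<^sub>E (UNIV :: 'a set))"
    using A I finA finI by (simp add: card_image card_PiE)
  then have "(\<lambda>f. restrict (g f) I) ` (A \<rightarrow>\<^sub>E UNIV) = (I \<rightarrow>\<^sub>E UNIV)"
    using finI by (intro card_subset_eq) (auto intro: finite_PiE)
  then have "restrict a I \<in> (\<lambda>f. restrict (g f) I) ` (A \<rightarrow>\<^sub>E UNIV)" by auto
  then obtain f where "restrict a I = restrict (g f) I" by auto
  then have "g f n = a n" if "n \<in> I" for n
    using that by (metis restrict_apply')
  then show ?thesis using that gD by blast
qed

text \<open>The codeword \<open>c\<close> has syndrome 0, so \<open>e\<close> solves the system. Two
  solutions supported on \<open>J\<close> differ by a codeword supported on \<open>J\<close>, which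
  is zero because \<open>J\<close> has fewer elements than the minimum distance. Since the positions
  are known, this works for up to one error less than the distance, not just half of it.\<close>

lemma solve_errors_unique:
  fixes E :: "(nat \<Rightarrow> 'k::field) set"
  assumes E: "row.subspace E" and H: "parity_check_matrix N E H"
    and J: "J \<subseteq> {1..N}" "card J < min_dist N E"
    and c: "c \<in> E" and e: "\<And>n. n \<notin> J \<Longrightarrow> e n = 0"
    and r: "\<And>n. n \<in> {1..N} \<Longrightarrow> r n = c n + e n"
  shows "solve_errors N E H J r = e"
  unfolding solve_errors_def
proof (rule the_equality)
  have "times_column N c H j = 0" if "j \<in> {1..N - row.dim E}" for j
    using c H that unfolding parity_check_matrix_def by blast
  moreover have "times_column N r H j = times_column N c H j + times_column N e H j" for j
    using r by (simp add: times_column_def distrib_right flip: sum.distrib)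
  ultimately have syndrome: "times_column N e H j = times_column N r H j"
    if "j \<in> {1..N - row.dim E}" for j
    using that by simp
  then show "(\<forall>n. n \<notin> J \<longrightarrow> e n = 0)
      \<and> (\<forall>j\<in>{1..N - row.dim E}. times_column N e H j = times_column N r H j)"
    using e by simp
  fix e' assume e': "(\<forall>n. n \<notin> J \<longrightarrow> e' n = 0)
      \<and> (\<forall>j\<in>{1..N - row.dim E}. times_column N e' H j = times_column N r H j)"
  define v where "v = e' - e"
  have v0: "v n = 0" if "n \<notin> J" for n using e e' that by (simp add: v_def)
  then have "v \<in> row_vectors N" using J(1) unfolding row_vectors_def by blast
  moreover have "\<forall>j\<in>{1..N - row.dim E}. times_column N v H j = 0"
    using e' syndrome by (simp add: v_def times_column_def left_diff_distrib sum_subtractf)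
  ultimately have "v \<in> E"
    using H unfolding parity_check_matrix_def by blast
  moreover have "{n \<in> {1..N}. v n \<noteq> 0} \<subseteq> J"
    using v0 by blast
  ultimately have "v = 0"
    using min_dist_le_card_support[of E v N J] E J finite_subset[OF J(1)]
    by (auto simp: row.subspace_0)
  then show "e' = e" by (simp add: v_def)
qed

section \<open>The blocks of pairs\<close>

text \<open>Lexicographic order places a pair at the zero-based position \<open>i\<close> whose
  quotient and remainder by \<open>K\<close> are \<open>b - 1\<close> and \<open>k - 1\<close>. A
  block is then an interval of positions, and questions about blocks become arithmetic.\<close>

lemma mem_pair_block:
  "(b, k) \<in> pair_block B K F s \<longleftrightarrow>
     (\<exists>i. (s - 1) * F \<le> i \<and> i < (s - 1) * F + F \<and> i < B * K \<and> b = i div K + 1 \<and> k = i mod K + 1)"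
  (is "_ \<longleftrightarrow> (\<exists>i. ?P i)")
proof -
  let ?m = "(s - 1) * F" and ?L = "List.product [1..<Suc B] [1..<Suc K]"
  have nth: "?L ! i = (i div K + 1, i mod K + 1)" if "i < B * K" for i
  proof -
    have "K > 0" using that by (cases K) auto
    moreover have "i div K < B" using that by (simp add: less_mult_imp_div_less)
    ultimately show ?thesis
      using that product_nth[of i "[1..<Suc B]" "[1..<Suc K]"]
      by (simp del: upt_Suc)
  qed
  have "(b, k) \<in> pair_block B K F s \<longleftrightarrow>
      (\<exists>i. i < F \<and> ?m + i < B * K \<and> ?L ! (?m + i) = (b, k))"
    unfolding pair_block_def by (auto simp: in_set_conv_nth less_diff_conv add.commute simp del: upt_Suc)
  also have "\<dots> \<longleftrightarrow> (\<exists>i. i < F \<and> ?m + i < B * K \<and> b = (?m + i) div K + 1 \<and> k = (?m + i) mod K + 1)"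
    using nth by (metis prod.inject)
  also have "\<dots> \<longleftrightarrow> (\<exists>i. ?P i)"
  proof
    assume "\<exists>i. ?P i"
    then obtain i where "?P i" ..
    then show "\<exists>i. i < F \<and> ?m + i < B * K \<and> b = (?m + i) div K + 1 \<and> k = (?m + i) mod K + 1"
      by (intro exI[of _ "i - ?m"]) auto
  next
    assume "\<exists>i. i < F \<and> ?m + i < B * K \<and> b = (?m + i) div K + 1 \<and> k = (?m + i) mod K + 1"
    then obtain i where "i < F \<and> ?m + i < B * K \<and> b = (?m + i) div K + 1 \<and> k = (?m + i) mod K + 1" ..
    then show "\<exists>i. ?P i" by (intro exI[of _ "?m + i"]) auto
  qed
  finally show ?thesis .
qed

lemma pair_block_bounds:
  assumes "(b, k) \<in> pair_block B K F s"
  shows "b \<in> {1..B}" "k \<in> {1..K}"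
proof -
  obtain i where i: "i < B * K" "b = i div K + 1" "k = i mod K + 1"
    using assms by (auto simp: mem_pair_block)
  then have "K > 0" by (cases K) auto
  then show "b \<in> {1..B}" "k \<in> {1..K}"
    using i by (auto simp: less_mult_imp_div_less Suc_le_eq)
qed

text \<open>Positions within one block differ by less than \<open>F \<le> K\<close>, so two of them
  with the same remainder modulo \<open>K\<close> coincide.\<close>

lemma pair_block_fst_unique:
  assumes "F \<le> K" "(b, k) \<in> pair_block B K F s" "(b', k) \<in> pair_block B K F s"
  shows "b = b'"
proof -
  obtain i i' where i: "(s - 1) * F \<le> i" "i < (s - 1) * F + F" "b = i div K + 1" "k = i mod K + 1"
    and i': "(s - 1) * F \<le> i'" "i' < (s - 1) * F + F" "b' = i' div K + 1" "k = i' mod K + 1"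
    using assms by (auto simp: mem_pair_block)
  have "int i mod int K = int i' mod int K"
    using i i' by (metis add_right_cancel of_nat_mod)
  then have "int K dvd int i - int i'" by (simp add: mod_eq_dvd_iff)
  moreover have "\<bar>int i - int i'\<bar> < int K" using i i' assms(1) by linarith
  ultimately have "i = i'" using zdvd_not_zless[of "\<bar>int i - int i'\<bar>" "int K"] by fastforce
  then show ?thesis using i i' by simp
qed

lemma the_pair_block:
  assumes "F \<le> K" "(b, k) \<in> pair_block B K F s"
  shows "(THE b. (b, k) \<in> pair_block B K F s) = b"
  using assms pair_block_fst_unique by blast

lemma pair_block_positions:
  "snd ` pair_block B K F s \<subseteq> {1..K}" "card (snd ` pair_block B K F s) \<le> F"
proof -
  show "snd ` pair_block B K F s \<subseteq> {1..K}" using pair_block_bounds(2) by force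
  let ?xs = "take F (drop ((s - 1) * F) (List.product [1..<Suc B] [1..<Suc K]))"
  have "card (snd ` set ?xs) \<le> card (set ?xs)" by (simp add: card_image_le)
  also have "\<dots> \<le> length ?xs" by (rule card_length)
  also have "\<dots> \<le> F" by simp
  finally show "card (snd ` pair_block B K F s) \<le> F" by (simp add: pair_block_def)
qed

text \<open>The pair has a single position \<open>i\<close>, which falls into block
  \<open>i div F + 1\<close>. Divisibility ensures that the \<open>K * B div F\<close> full blocks
  exhaust the list. This makes the \<open>THE\<close> in \<open>star_decode\<close> well
  defined.\<close>

lemma pair_block_iteration_unique:
  assumes F: "F dvd K * B" and b: "b \<in> {1..B}" and k: "k \<in> {1..K}"
  shows "\<exists>!s. s \<in> {1..K * B div F} \<and> (b, k) \<in> pair_block B K F s"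
proof -
  define i where "i = (b - 1) * K + (k - 1)"
  have K: "K > 0" "B > 0" using b k by auto
  then have F0: "F > 0" using F by (auto intro!: Nat.gr0I)
  have "i < (b - 1) * K + K" using k unfolding i_def by auto
  also have "\<dots> = b * K" using b by (cases b) auto
  also have "\<dots> \<le> B * K" using b by simp
  finally have iB: "i < B * K" .
  have "k - 1 < K" using k by auto
  then have ib: "b = i div K + 1" "k = i mod K + 1"
    using b k div_mult_self3[of K "k - 1" "b - 1"]
    by (simp_all add: i_def del: diff_add_assoc diff_add_assoc2 add_diff_assoc)
  have pair_iff: "(b, k) \<in> pair_block B K F s \<longleftrightarrow> (s - 1) * F \<le> i \<and> i < (s - 1) * F + F" for s
  proof -
    have "i' = i" if "b = i' div K + 1" "k = i' mod K + 1" for i'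
      using that ib by (metis add_right_cancel div_mult_mod_eq)
    then show ?thesis using ib iB by (auto simp: mem_pair_block)
  qed
  \<comment> \<open>By truncated subtraction this covers \<open>s = 0\<close> as well, which yields
    the same block as \<open>s = 1\<close>; uniqueness of \<open>s\<close> therefore comes from the
    range starting at 1.\<close>
  have iff: "(s - 1) * F \<le> i \<and> i < (s - 1) * F + F \<longleftrightarrow> i div F = s - 1" for s
  proof
    assume "(s - 1) * F \<le> i \<and> i < (s - 1) * F + F"
    then show "i div F = s - 1" by (intro div_nat_eqI) (simp_all add: mult.commute)
  next
    assume "i div F = s - 1"
    then show "(s - 1) * F \<le> i \<and> i < (s - 1) * F + F"
      using F0 div_times_less_eq_dividend[of i F] dividend_less_div_times[of F i] by simp
  qed
  have "i div F < K * B div F"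
    using iB F F0 by (metis dvd_div_mult_self less_mult_imp_div_less mult.commute)
  then have "i div F + 1 \<in> {1..K * B div F}" by simp
  then show ?thesis
    unfolding pair_iff iff by (intro ex1I[of _ "i div F + 1"]) auto
qed

section \<open>Masks and errors\<close>

lemma mask_query_apply:
  "mask_query emb bas d n y = (\<Sum>j\<in>{1..length bas}. emb (d j n) * (bas ! (j - 1)) y)"
proof -
  have "(\<Sum>j\<in>A. query_scale emb (d j n) (bas ! (j - 1))) y
      = (\<Sum>j\<in>A. emb (d j n) * (bas ! (j - 1)) y)" if "finite A" for A
    using that by induction (auto simp: query_scale_def)
  then show ?thesis by (simp add: mask_query_def)
qed

lemma mask_query_add:
  assumes "field_embedding emb"
  shows "mask_query emb bas (d + d') n = mask_query emb bas d n + mask_query emb bas d' n"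
  using assms
  by (auto simp: fun_eq_iff mask_query_apply field_embedding_def distrib_right sum.distrib)

lemma mask_query_mem:
  assumes emb: "field_embedding emb" and Q: "module.subspace (query_scale emb) \<Q>"
    and bas: "query_basis emb \<Q> bas"
  shows "mask_query emb bas d n \<in> \<Q>"
proof -
  interpret Q: vector_space "query_scale emb" by (rule vector_space_query_scale[OF emb])
  have "set bas \<subseteq> \<Q>" using bas Q.span_superset by (auto simp: query_basis_def)
  then show ?thesis
    unfolding mask_query_def using Q by (intro Q.subspace_sum Q.subspace_scale) (auto intro!: nth_mem)
qed

lemma query_basis_coordinates:
  assumes emb: "field_embedding emb" and bas: "query_basis emb \<Q> bas" and "\<psi> \<in> \<Q>"
  obtains c where "\<psi> = (\<Sum>j\<in>{1..length bas}. query_scale emb (c j) (bas ! (j - 1)))"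
proof -
  interpret Q: vector_space "query_scale emb" by (rule vector_space_query_scale[OF emb])
  have "\<psi> \<in> Q.span (set bas)" "distinct bas" using assms by (auto simp: query_basis_def)
  then obtain u where "\<psi> = (\<Sum>v\<in>set bas. query_scale emb (u v) v)"
    by (auto simp: Q.span_finite)
  also have "\<dots> = (\<Sum>j\<in>{1..length bas}. query_scale emb (u (bas ! (j - 1))) (bas ! (j - 1)))"
  \<comment> \<open>Distinctness of \<open>bas\<close> allows the passage from coefficients indexed
    by basis elements to coefficients indexed by list positions counted from 1.\<close>
  proof (rule sum.reindex_bij_betw[symmetric, where h = "\<lambda>j. bas ! (j - 1)"])
    have "bij_betw ((!) bas \<circ> (\<lambda>j. j - 1)) {1..length bas} (set bas)"
      by (rule bij_betw_trans[OF _ bij_betw_nth[OF \<open>distinct bas\<close> refl refl]])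
        (rule bij_betwI[of _ _ _ Suc]; auto)
    then show "bij_betw (\<lambda>j. bas ! (j - 1)) {1..length bas} (set bas)" by (simp add: o_def)
  qed
  finally show ?thesis by (rule that)
qed

text \<open>For each basis index \<open>j\<close>, the \<open>j\<close>-th coordinates of the
  targets \<open>f n\<close> prescribe values at the \<open>T\<close> positions in \<open>I\<close>,
  and the MDS property supplies a codeword with these values. Hence masks can imitate any queries to
  \<open>T\<close> servers.\<close>

lemma mask_query_interpolation:
  fixes emb :: "'f::{field,finite} \<Rightarrow> 'k::field"
  assumes emb: "field_embedding emb" and bas: "query_basis emb \<Q> bas"
    and mds: "MDS_code N T D" and I: "I \<subseteq> {1..N}" "card I = T"
    and f: "\<And>n. f n \<in> \<Q>"
  obtains \<delta> where "\<And>j. \<delta> j \<in> D" "\<And>n. n \<in> I \<Longrightarrow> mask_query emb bas \<delta> n = f n"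
proof -
  have "\<exists>c. f n = (\<Sum>j\<in>{1..length bas}. query_scale emb (c j) (bas ! (j - 1)))" for n
    using query_basis_coordinates[OF emb bas f] by metis
  then obtain c where c: "\<And>n. f n = (\<Sum>j\<in>{1..length bas}. query_scale emb (c n j) (bas ! (j - 1)))"
    by metis
  have "\<exists>d\<in>D. \<forall>n\<in>I. d n = c n j" for j
    using MDS_code_interpolation[OF mds I, of "\<lambda>n. c n j"] by metis
  then obtain \<delta> where \<delta>: "\<And>j. \<delta> j \<in> D" "\<And>j n. n \<in> I \<Longrightarrow> \<delta> j n = c n j" by metis
  show ?thesis
    using \<delta> c by (intro that[of \<delta>]) (simp_all add: mask_query_def)
qed

text \<open>The masked responses are the sum over \<open>j\<close> of the star product of the
  responses to the \<open>j\<close>-th basis query with the embedded codeword \<open>d j\<close>.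
  They form the part of the total response that the parity-check matrix annihilates.\<close>

lemma mask_codeword:
  assumes emb: "field_embedding emb" and bas: "query_basis emb \<Q> bas"
    and d: "\<And>j. j \<in> {1..length bas} \<Longrightarrow> d j \<in> D"
  shows "(\<lambda>n. if n \<in> {1..N} then mask_query emb bas d n (stored_column emb K G X n) else 0)
     \<in> star_product (query_code emb N K G \<Q>) (extend_scalars emb D)"
proof -
  interpret Q: vector_space "query_scale emb" by (rule vector_space_query_scale[OF emb])
  have basQ: "set bas \<subseteq> \<Q>" using bas Q.span_superset by (auto simp: query_basis_def)
  define a where "a j = (\<lambda>n. if n \<in> {1..N} then (bas ! (j - 1)) (stored_column emb K G X n) else 0)"
    for j
  have a: "a j \<in> query_code emb N K G \<Q>" if "j \<in> {1..length bas}" for j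
  proof -
    have "bas ! (j - 1) \<in> \<Q>" using basQ that by (auto intro!: nth_mem)
    then show ?thesis unfolding query_code_def a_def by (intro row.span_base) auto
  qed
  have emb_d: "(\<lambda>n. emb (d j n)) \<in> extend_scalars emb D" if "j \<in> {1..length bas}" for j
    unfolding extend_scalars_def using d[OF that] by (intro row.span_base) auto
  have sum: "(\<Sum>j\<in>J. (\<lambda>n. a j n * emb (d j n))) n = (\<Sum>j\<in>J. a j n * emb (d j n))" if "finite J" for J n
    using that by induction auto
  have "(\<Sum>j\<in>{1..length bas}. (\<lambda>n. a j n * emb (d j n)))
      \<in> star_product (query_code emb N K G \<Q>) (extend_scalars emb D)"
    unfolding star_product_def
    by (intro row.span_sum row.span_base CollectI exI conjI refl) (use a emb_d in auto)
  also have "(\<Sum>j\<in>{1..length bas}. (\<lambda>n. a j n * emb (d j n)))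
      = (\<lambda>n. if n \<in> {1..N} then mask_query emb bas d n (stored_column emb K G X n) else 0)"
    by (intro ext, subst sum) (auto simp: mask_query_apply a_def mult.commute intro!: sum.neutral)
  finally show ?thesis .
qed

text \<open>Taking the zero query off the block splits every query into mask plus error, so that
  decoding and privacy can treat all servers uniformly.\<close>

definition error_query ::
    "nat \<Rightarrow> nat \<Rightarrow> nat \<Rightarrow> ('k::field, 'm::finite) query list \<Rightarrow> nat \<Rightarrow> nat \<Rightarrow> ('k, 'm) query" where
  "error_query K B F \<phi> s n =
     (if \<exists>b. (b, n) \<in> pair_block B K F s
      then \<phi> ! ((THE b. (b, n) \<in> pair_block B K F s) - 1) else 0)"

lemma star_query_eq:
  "star_query emb K B F bas \<phi> d s n = mask_query emb bas (d s) n + error_query K B F \<phi> s n"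
  by (simp add: star_query_def error_query_def)

lemma error_query_eq:
  assumes "F \<le> K" "(b, n) \<in> pair_block B K F s"
  shows "error_query K B F \<phi> s n = \<phi> ! (b - 1)"
  using assms the_pair_block by (auto simp: error_query_def)

lemma error_query_eq_0: "n \<notin> snd ` pair_block B K F s \<Longrightarrow> error_query K B F \<phi> s n = 0"
  by (force simp: error_query_def)

lemma error_query_mem:
  assumes "F \<le> K" "length \<phi> = B" "set \<phi> \<subseteq> \<Q>" "0 \<in> \<Q>"
  shows "error_query K B F \<phi> s n \<in> \<Q>"
proof (cases "\<exists>b. (b, n) \<in> pair_block B K F s")
  case True
  then obtain b where b: "(b, n) \<in> pair_block B K F s" ..
  then have "b - 1 < length \<phi>" using pair_block_bounds(1) assms(2) by force
  then show ?thesis using assms(3) unfolding error_query_eq[OF assms(1) b] by (auto intro: nth_mem)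
next
  case False
  then show ?thesis using assms(4) by (simp add: error_query_def)
qed

section \<open>Correctness of decoding\<close>

lemma stored_column_systematic:
  assumes "field_embedding emb" "systematic K G" "k \<in> {1..K}"
  shows "stored_column emb K G X k = X k"
proof -
  \<comment> \<open>Preservation of 0 follows from additivity by cancellation.\<close>
  have "emb 0 = 0" using assms(1) by (metis add_cancel_right_right field_embedding_def)
  then have "emb (G j k) *s X j = (if j = k then X j else 0)" if "j \<in> {1..K}" for j
    using assms that by (auto simp: systematic_def field_embedding_def)
  then have "stored_column emb K G X k = (\<Sum>j\<in>{1..K}. if j = k then X j else 0)"
    by (simp add: stored_column_def)
  then show ?thesis using assms(3) by simp
qed

text \<open>Otherwise row \<open>K\<close> would have its entry 1 in column \<open>K\<close>, beyond
  the code length. This places the error positions, which lie in \<open>{1..K}\<close>, among the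
  servers.\<close>

lemma systematic_length_le:
  assumes "generator_matrix N K G C" "systematic K G"
  shows "K \<le> N"
proof (rule ccontr)
  assume "\<not> K \<le> N"
  then have K: "K \<in> {1..K}" "K \<notin> {1..N}" by auto
  then have "G K \<in> row_vectors N" using assms(1) unfolding generator_matrix_def by blast
  then have "G K K = 0" using K(2) unfolding row_vectors_def by blast
  moreover have "G K K = 1" using assms(2) K(1) unfolding systematic_def by auto
  ultimately show False by simp
qed

text \<open>In the iteration handling \<open>(b, k)\<close>, the response is a codeword of
  \<open>E\<close> plus an error vector supported on at most \<open>F\<close> known positions, fewer
  than the minimum distance. Systematic storage makes the error at position \<open>k\<close> equal
  to the wanted value at \<open>X k\<close>.\<close>

lemma star_decode_correct:
  fixes emb :: "'f::field \<Rightarrow> 'k::field" and bas :: "('k, 'm::finite) query list"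
  assumes emb: "field_embedding emb" and G: "generator_matrix N K G C" "systematic K G"
    and bas: "query_basis emb \<Q> bas"
    and E: "E = star_product (query_code emb N K G \<Q>) (extend_scalars emb D)"
    and H: "parity_check_matrix N E H"
    and F: "F \<le> K" "F < min_dist N E" "F dvd K * B"
    and d: "\<And>s j. s \<in> {1..K * B div F} \<Longrightarrow> j \<in> {1..length bas} \<Longrightarrow> d s j \<in> D"
    and bk: "b \<in> {1..B}" "k \<in> {1..K}"
    and r: "\<And>s n. s \<in> {1..K * B div F} \<Longrightarrow> n \<in> {1..N} \<Longrightarrow>
      r s n = star_query emb K B F bas \<phi> d s n (stored_column emb K G X n)"
  shows "star_decode N K B (K * B div F) F E H r b k = (\<phi> ! (b - 1)) (X k)"
proof -
  define s where "s = (THE s. s \<in> {1..K * B div F} \<and> (b, k) \<in> pair_block B K F s)"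
  have s: "s \<in> {1..K * B div F}" "(b, k) \<in> pair_block B K F s"
    using theI'[OF pair_block_iteration_unique[OF F(3) bk]] by (auto simp: s_def)
  let ?J = "snd ` pair_block B K F s"
  define e where "e n = error_query K B F \<phi> s n (stored_column emb K G X n)" for n
  have "solve_errors N E H ?J (r s) = e"
  proof (rule solve_errors_unique[OF _ H])
    show "row.subspace E" by (simp add: E star_product_def row.subspace_span)
    show "?J \<subseteq> {1..N}"
      using pair_block_positions(1) systematic_length_le[OF G] by fastforce
    show "card ?J < min_dist N E" using pair_block_positions(2) F(2) le_less_trans by blast
    show "(\<lambda>n. if n \<in> {1..N} then mask_query emb bas (d s) n (stored_column emb K G X n) else 0) \<in> E"
      unfolding E using d s(1) by (intro mask_codeword[OF emb bas]) auto
    show "e n = 0" if "n \<notin> ?J" for n using error_query_eq_0[OF that, of \<phi>] by (simp add: e_def zero_fun_def)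
  qed (use r[OF s(1)] in \<open>simp add: e_def star_query_eq\<close>)
  moreover have "e k = (\<phi> ! (b - 1)) (X k)"
    using error_query_eq[OF F(1) s(2), of \<phi>] stored_column_systematic[OF emb G(2) bk(2), of X]
    by (simp add: e_def)
  ultimately show ?thesis by (simp add: star_decode_def s_def Let_def)
qed

section \<open>Privacy\<close>

text \<open>The errors lie in the span of the masks restricted to \<open>I\<close>, and a uniformly distributed mask
  family is invariant under translation, so adding the errors does not change the law of the
  queries sent to \<open>I\<close>.\<close>

lemma star_query_law_invariant:
  fixes emb :: "'f::{field,finite} \<Rightarrow> 'k::field" and bas :: "('k, 'm::finite) query list"
  assumes emb: "field_embedding emb" and Q: "module.subspace (query_scale emb) \<Q>"
    and bas: "query_basis emb \<Q> bas"
    and mds: "MDS_code N T D" and I: "I \<subseteq> {1..N}" "card I = T"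
    and \<phi>: "F \<le> K" "length \<phi> = B" "set \<phi> \<subseteq> \<Q>"
  shows "map_pmf (\<lambda>d. map (\<lambda>s. map (star_query emb K B F bas \<phi> d s) (sorted_list_of_set I)) [1..<Suc S])
      (Pi_pmf {1..S} 0 (\<lambda>_. Pi_pmf {1..length bas} 0 (\<lambda>_. pmf_of_set D)))
    = map_pmf (\<lambda>d. map (\<lambda>s. map (mask_query emb bas (d s)) (sorted_list_of_set I)) [1..<Suc S])
      (Pi_pmf {1..S} 0 (\<lambda>_. Pi_pmf {1..length bas} 0 (\<lambda>_. pmf_of_set D)))"
    (is "map_pmf ?q ?p = map_pmf ?m ?p")
proof -
  interpret Q: vector_space "query_scale emb" by (rule vector_space_query_scale[OF emb])
  have D: "D \<subseteq> row_vectors N" "row.subspace D" using mds by (auto simp: MDS_code_def linear_code_def)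
  have finD: "finite D" using D finite_row_vectors finite_subset by blast
  have D0: "0 \<in> D" using D(2) by (rule row.subspace_0)
  \<comment> \<open>Independent uniform codewords amount to one uniform choice from the finite set
    \<open>W\<close> of families that vanish outside the index ranges.\<close>
  define V where "V = PiE_dflt {1..length bas} 0 (\<lambda>_. D)"
  define W where "W = PiE_dflt {1..S} 0 (\<lambda>_. V)"
  have V0: "0 \<in> V" and W0: "0 \<in> W" using D0 by (auto simp: V_def W_def PiE_dflt_def)
  have fin: "finite V" "finite W" using finD by (auto simp: V_def W_def)
  have p: "?p = pmf_of_set W"
  proof -
    have "Pi_pmf {1..length bas} 0 (\<lambda>_. pmf_of_set D) = pmf_of_set V"
      unfolding V_def using finD D0 by (intro Pi_pmf_of_set) auto
    moreover have "Pi_pmf {1..S} 0 (\<lambda>_. pmf_of_set V) = pmf_of_set W"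
      unfolding W_def using fin(1) V0 by (intro Pi_pmf_of_set) auto
    ultimately show ?thesis by simp
  qed
  have "\<exists>\<delta>. (\<forall>j. \<delta> j \<in> D) \<and> (\<forall>n\<in>I. mask_query emb bas \<delta> n = error_query K B F \<phi> s n)" for s
    using mask_query_interpolation[OF emb bas mds I, of "error_query K B F \<phi> s"]
      error_query_mem[OF \<phi> Q.subspace_0[OF Q]]
    by metis
  then obtain \<delta> where \<delta>: "\<And>s j. \<delta> s j \<in> D"
    "\<And>s n. n \<in> I \<Longrightarrow> mask_query emb bas (\<delta> s) n = error_query K B F \<phi> s n"
    by metis
  \<comment> \<open>Cutting \<delta> to the index ranges keeps the default value 0, so that
    translation by \<Delta> maps \<open>W\<close> onto itself.\<close>
  define \<Delta> where "\<Delta> = (\<lambda>s j. if s \<in> {1..S} \<and> j \<in> {1..length bas} then \<delta> s j else 0)"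
  have \<Delta>: "mask_query emb bas (\<Delta> s) n = error_query K B F \<phi> s n" if "s \<in> {1..S}" "n \<in> I" for s n
    using that \<delta>(2)[of n s] by (simp add: \<Delta>_def mask_query_def)
  have "bij_betw (\<lambda>d. d + \<Delta>) W W"
  proof (rule bij_betwI[where g = "\<lambda>d. d - \<Delta>"])
    show "(\<lambda>d. d + \<Delta>) \<in> W \<rightarrow> W" "(\<lambda>d. d - \<Delta>) \<in> W \<rightarrow> W"
      using \<delta>(1) row.subspace_add[OF D(2)] row.subspace_diff[OF D(2)]
      by (auto simp: W_def V_def PiE_dflt_def \<Delta>_def)
  qed auto
  then have shift: "pmf_of_set W = map_pmf (\<lambda>d. d + \<Delta>) (pmf_of_set W)"
    using W0 fin by (subst map_pmf_of_set_bij_betw) auto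
  \<comment> \<open>After the shift, additivity turns each mask seen by a server in \<open>I\<close>
    into mask plus error, which is the actual query.\<close>
  have "map_pmf ?m ?p = map_pmf (\<lambda>d. ?m (d + \<Delta>)) ?p"
    unfolding p by (subst shift) (simp only: pmf.map_comp o_def)
  also have "(\<lambda>d. ?m (d + \<Delta>)) = ?q"
    using \<Delta> finite_subset[OF I(1)]
    by (auto simp: star_query_eq mask_query_add[OF emb] simp del: upt_Suc)
  finally show ?thesis ..
qed

section \<open>Assembly of correctness, privacy and rate\<close>

theorem theorem2:
  fixes emb :: "'f::{field,finite} \<Rightarrow> 'k::{field,finite}"
    and N K T B F :: nat
    and C D :: "(nat \<Rightarrow> 'f) set"
    and G :: "nat \<Rightarrow> nat \<Rightarrow> 'f"
    and \<Q> :: "('k, 'm::finite) query set"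
    and bas :: "('k, 'm) query list"
    and law :: "('k, 'm) query list pmf"
    and E :: "(nat \<Rightarrow> 'k) set"
    and H :: "nat \<Rightarrow> nat \<Rightarrow> 'k"
  assumes "field_embedding emb"
    and "linear_code N K C" and "generator_matrix N K G C" and "systematic K G"
    and "MDS_code N T D"
    and "module.subspace (query_scale emb) \<Q>" and "query_basis emb \<Q> bas"
    and "B \<ge> 1"
    and "\<forall>\<phi>\<in>set_pmf law. length \<phi> = B \<and> set \<phi> \<subseteq> \<Q>"
    and "E = star_product (query_code emb N K G \<Q>) (extend_scalars emb D)"
    and "parity_check_matrix N E H"
    and "F = min (min_dist N E - 1) K"
    and "F dvd K * B"
  shows "is_pc_scheme emb G (star_product_scheme emb N K B F D \<Q> bas law E H) \<and>
         T_private T (star_product_scheme emb N K B F D \<Q> bas law E H) \<and>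
         rate (star_product_scheme emb N K B F D \<Q> bas law E H) = real F / real N"
proof -
  let ?P = "star_product_scheme emb N K B F D \<Q> bas law E H"
  let ?S = "K * B div F"
  interpret Q: vector_space "query_scale emb" by (rule vector_space_query_scale[OF assms(1)])
  have D: "D \<subseteq> row_vectors N" "row.subspace D"
    using assms(5) by (auto simp: MDS_code_def linear_code_def)
  have "finite D" "D \<noteq> {}"
    using D finite_row_vectors finite_subset row.subspace_0[OF D(2)] by auto
  then have mask_mem: "d s j \<in> D"
    if "(\<phi>, d) \<in> set_pmf (star_sample ?S (length bas) D law)" "s \<in> {1..?S}" "j \<in> {1..length bas}"
    for \<phi> d s j
    using that by (auto simp: star_sample_def set_Pi_pmf PiE_dflt_def)
  have F: "F \<le> K" using assms(12) by simp
  \<comment> \<open>Divisibility excludes \<open>F = 0\<close> when \<open>K * B\<close> is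
    positive. Positivity is what turns the truncated \<open>min_dist N E - 1\<close> into a strict
    bound.\<close>
  have F_dist: "F < min_dist N E" if "K > 0"
  proof -
    have "F > 0" using that assms(8,13) by (auto intro!: Nat.gr0I)
    then show ?thesis using assms(12) by auto
  qed
  have scheme: "is_pc_scheme emb G ?P"
    unfolding is_pc_scheme_def
  proof (intro conjI ballI allI)
    show "map_pmf (funs ?P) (sample ?P) = fun_law ?P"
      by (simp add: star_product_scheme_def Let_def star_sample_def map_fst_pair_pmf)
  next
    fix \<omega> s n assume "\<omega> \<in> set_pmf (sample ?P)" "s \<in> {1..num_iterations ?P}" "n \<in> {1..num_servers ?P}"
    then show "query ?P \<omega> s n \<in> query_space ?P"
      using assms(9) error_query_mem[OF F _ _ Q.subspace_0[OF assms(6)]]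
        mask_query_mem[OF assms(1,6,7)]
      by (auto simp: star_product_scheme_def Let_def star_sample_def star_query_eq
          intro!: Q.subspace_add[OF assms(6)])
  next
    fix \<omega> b k and X :: "nat \<Rightarrow> ('k, 'm) vec"
    assume "\<omega> \<in> set_pmf (sample ?P)" and bk: "b \<in> {1..block_length ?P}" "k \<in> {1..num_files ?P}"
    then obtain \<phi> d where \<omega>: "\<omega> = (\<phi>, d)" "(\<phi>, d) \<in> set_pmf (star_sample ?S (length bas) D law)"
      by (cases \<omega>) (auto simp: star_product_scheme_def Let_def)
    have bk': "b \<in> {1..B}" "k \<in> {1..K}" using bk by (auto simp: star_product_scheme_def Let_def)
    then have "F < min_dist N E" by (intro F_dist) auto
    then have "star_decode N K B ?S F E H (responses ?P (stored_column emb K G X) \<omega>) b k = (\<phi> ! (b - 1)) (X k)"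
      using mask_mem[OF \<omega>(2)] bk'
      by (intro star_decode_correct[OF assms(1,3,4,7,10,11) F _ assms(13)])
        (auto simp: responses_def star_product_scheme_def Let_def \<omega>(1))
    then show "decode ?P \<omega> (responses ?P (stored_column emb (num_files ?P) G X) \<omega>) b k
        = (funs ?P \<omega> ! (b - 1)) (X k)"
      by (simp add: star_product_scheme_def Let_def \<omega>(1))
  qed (use assms(9) in \<open>auto simp: star_product_scheme_def Let_def\<close>)
  have "protects_against ?P I" if I: "I \<subseteq> {1..N}" "card I = T" for I
  proof -
    let ?p = "Pi_pmf {1..?S} 0 (\<lambda>_. Pi_pmf {1..length bas} 0 (\<lambda>_. pmf_of_set D))"
    define q where "q \<phi> d =
        map (\<lambda>s. map (star_query emb K B F bas \<phi> d s) (sorted_list_of_set I)) [1..<Suc ?S]" for \<phi> d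
    define \<nu> where "\<nu> =
        map_pmf (\<lambda>d. map (\<lambda>s. map (mask_query emb bas (d s)) (sorted_list_of_set I)) [1..<Suc ?S]) ?p"
    \<comment> \<open>Given any \<phi> in the support of \<open>law\<close>, the queries to
      \<open>I\<close> have the same distribution \<nu>; a conditional law that is constant in
      \<phi> makes the joint law a product.\<close>
    have q: "map_pmf (q \<phi>) ?p = \<nu>" if "\<phi> \<in> set_pmf law" for \<phi>
      unfolding q_def \<nu>_def
      using assms(9) that by (intro star_query_law_invariant[OF assms(1,6,7,5) I F]) auto
    have "map_pmf (\<lambda>\<omega>. (fst \<omega>, q (fst \<omega>) (snd \<omega>))) (pair_pmf law ?p)
        = bind_pmf law (\<lambda>\<phi>. map_pmf (Pair \<phi>) (map_pmf (q \<phi>) ?p))"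
      by (simp add: pair_pmf_def map_bind_pmf map_pmf_def bind_assoc_pmf bind_return_pmf)
    also have "\<dots> = bind_pmf law (\<lambda>\<phi>. map_pmf (Pair \<phi>) \<nu>)"
      using q by (intro bind_pmf_cong) auto
    also have "\<dots> = pair_pmf law \<nu>" by (simp add: pair_pmf_def map_pmf_def)
    finally show ?thesis
      unfolding protects_against_def
      by (intro mutual_information_eq_0_pmf[of _ _ _ law \<nu>])
        (simp add: star_product_scheme_def Let_def star_sample_def queries_to_def q_def
          case_prod_unfold del: upt_Suc)
  qed
  then have privacy: "T_private T ?P"
    by (simp add: T_private_def star_product_scheme_def Let_def)
  have "rate ?P = real F / real N"
  \<comment> \<open>For \<open>K = 0\<close> also \<open>F = 0\<close>, and both quotients are 0.
    Otherwise \<open>K * B = F * S\<close> with \<open>S > 0\<close>, and \<open>S\<close>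
    cancels.\<close>
  proof (cases "K = 0")
    case True
    then show ?thesis using F by (simp add: rate_def star_product_scheme_def Let_def)
  next
    case False
    then have "K * B > 0" using assms(8) by simp
    then obtain S where S: "K * B = F * S" "S > 0" "F > 0"
      using assms(13) by (metis dvdE mult_is_0 neq0_conv)
    then show ?thesis
      by (simp add: rate_def star_product_scheme_def Let_def)
  qed
  with scheme privacy show ?thesis by blast
qed

end
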